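(* Let $R$ be a commutative semiring and $v:R\to M$ a valuation. The supervaluation $\varphi_v:R\to U(v)$ dominates every supervaluation $\psi:R\to U$ covering $v$. Thus these supervaluations $\psi$ correspond uniquely with the transmissive maps $\alpha:U(v)\to U$ covering $\mathrm{id}_M$ (via $\psi=\alpha\circ\varphi_v$). These transmissive maps $\alpha$ are semiring homomorphisms.
   Context: All semirings are commutative with $0$ and $1$. A semiring $M$ is bipotent if $a+b\in\{a,b\}$ for all $a,b\in M$; it is totally ordered by $a\le b\iff a+b=b$. A supertropical semiring is a semiring $U$ such that, with $e=e_U:=1+1$: (1) $1+1=1+1+1+1$; (2) $a+a=b+b$ implies $a+b=a+a$; (3) $a+a\ne b+b$ implies $a+b\in\{a,b\}$. Then $e$ is idempotent and $eU$ is a bipotent semiring with unit element $e$. $\mathcal T(U):=U\setminus eU$. A valuation on $R$ is a map $v:R\to M$ into a bipotent semiring $M\ne\{0\}$ such that $M\setminus\{0\}$ is closed under multiplication and is a cancellative monoid, with $v(0)=0$, $v(1)=1$, $v(xy)=v(x)v(y)$, $v(x+y)\le v(x)+v(y)=\max(v(x),v(y))$. A supervaluation on $R$ is a map $\psi:R\to U$ into a supertropical semiring with $\psi(0)=0$, $\psi(1)=1$, $\psi(ab)=\psi(a)\psi(b)$ and $e\psi(a+b)\le e\psi(a)+e\psi(b)$. It covers $v:R\to M$ if $eU=M$ and $e\psi(a)=v(a)$ for all $a\in R$. $\varphi:R\to U$ dominates $\psi:R\to V$ if for all $a,b\in R$: (D1) $\varphi(a)=\varphi(b)\Rightarrow\psi(a)=\psi(b)$;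 (D2) $e\varphi(a)\le e\varphi(b)\Rightarrow e\psi(a)\le e\psi(b)$; (D3) $\varphi(a)\in eU\Rightarrow\psi(a)\in eV$. A map $\alpha:U\to V$ between supertropical semirings is transmissive if $\alpha(0)=0$, $\alpha(1)=1$, $\alpha(xy)=\alpha(x)\alpha(y)$ for all $x,y\in U$, $\alpha(e_U)=e_V$, and $\alpha(x+y)=\alpha(x)+\alpha(y)$ for all $x,y\in eU$. It covers the map $\gamma:eU\to eV$ obtained from it by restriction. Definition of $U(v)$ and $\varphi_v$: let $\mathfrak q=v^{-1}(0)$. As a set $U(v)=(R\setminus\mathfrak q)\,\dot\cup\,M$. The multiplication extends the given ones on the monoid $R\setminus\mathfrak q$ and on $M$, and $a\cdot x=x\cdot a=v(a)x$ for $a\in R\setminus\mathfrak q$, $x\in M$. Define $e\cdot a=v(a)$ for $a\in R\setminus \mathfrak q$ and $e\cdot x=x$ for $x\in M$ (so $e=1_M$); addition on $U(v)$ is $x+y=x$ if $ex>ey$, $x+y=y$ if $ex<ey$, $x+y=ex$ if $ex=ey$. This is a supertropical semiring with ghost ideal $M$ and zero $0_M$. The map $\varphi_v:R\to U(v)$ is $\varphi_v(a)=a$ for $a\in R\setminus\mathfrak q$ and $\varphi_v(a)=0$ for $a\in\mathfrak q$; it is a supervaluation covering $v$. *)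

theory Defs
  imports "HOL-Algebra.QuotRing" "HOL-Library.FuncSet"
begin

section \<open>Commutative semirings, bipotent semirings, valuations\<close>

text \<open>The zero semiring is admitted.\<close>

locale commutative_semiring = semiring R + comm_monoid R for R (structure)

text \<open>The library notion \<open>ring_hom\<close> does not mention the zero, which has to be
  preserved explicitly when there are no additive inverses.\<close>

definition semiring_hom ::
  "('a, 'm) ring_scheme \<Rightarrow> ('b, 'n) ring_scheme \<Rightarrow> ('a \<Rightarrow> 'b) set" where
  "semiring_hom R S = {h \<in> ring_hom R S. h \<zero>\<^bsub>R\<^esub> = \<zero>\<^bsub>S\<^esub>}"

definition bip_le :: "('a, 'm) ring_scheme \<Rightarrow> 'a \<Rightarrow> 'a \<Rightarrow> bool" where
  "bip_le M x y \<longleftrightarrow> x \<oplus>\<^bsub>M\<^esub> y = y"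

definition bip_less :: "('a, 'm) ring_scheme \<Rightarrow> 'a \<Rightarrow> 'a \<Rightarrow> bool" where
  "bip_less M x y \<longleftrightarrow> bip_le M x y \<and> x \<noteq> y"

locale bipotent_semiring = commutative_semiring M for M (structure) +
  assumes bipotent: "\<lbrakk>a \<in> carrier M; b \<in> carrier M\<rbrakk> \<Longrightarrow> a \<oplus> b \<in> {a, b}"

text \<open>That the nonzero elements of \<open>M\<close> contain the unit follows from \<open>M \<noteq> {0}\<close>, so closure
  under multiplication makes them a submonoid. In a bipotent semiring \<open>v x + v y\<close> is the
  maximum of \<open>v x\<close> and \<open>v y\<close>.\<close>

locale valuation = R?: commutative_semiring R + M?: bipotent_semiring M
  for R :: "('r, 'a) ring_scheme" (structure)
    and M :: "('m, 'b) ring_scheme" (structure)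
    and v :: "'r \<Rightarrow> 'm" +
  assumes nontrivial: "carrier M \<noteq> {\<zero>\<^bsub>M\<^esub>}"
    and nonzero_closed: "\<lbrakk>x \<in> carrier M - {\<zero>\<^bsub>M\<^esub>}; y \<in> carrier M - {\<zero>\<^bsub>M\<^esub>}\<rbrakk>
      \<Longrightarrow> x \<otimes>\<^bsub>M\<^esub> y \<in> carrier M - {\<zero>\<^bsub>M\<^esub>}"
    and nonzero_cancel: "\<lbrakk>x \<in> carrier M - {\<zero>\<^bsub>M\<^esub>}; y \<in> carrier M - {\<zero>\<^bsub>M\<^esub>};
        z \<in> carrier M - {\<zero>\<^bsub>M\<^esub>}; x \<otimes>\<^bsub>M\<^esub> y = x \<otimes>\<^bsub>M\<^esub> z\<rbrakk> \<Longrightarrow> y = z"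
    and val_closed: "v \<in> carrier R \<rightarrow> carrier M"
    and val_zero: "v \<zero>\<^bsub>R\<^esub> = \<zero>\<^bsub>M\<^esub>"
    and val_one: "v \<one>\<^bsub>R\<^esub> = \<one>\<^bsub>M\<^esub>"
    and val_mult: "\<lbrakk>a \<in> carrier R; b \<in> carrier R\<rbrakk> \<Longrightarrow> v (a \<otimes>\<^bsub>R\<^esub> b) = v a \<otimes>\<^bsub>M\<^esub> v b"
    and val_add: "\<lbrakk>a \<in> carrier R; b \<in> carrier R\<rbrakk>
      \<Longrightarrow> bip_le M (v (a \<oplus>\<^bsub>R\<^esub> b)) (v a \<oplus>\<^bsub>M\<^esub> v b)"

section \<open>Supertropical semirings\<close>

locale supertropical_semiring = commutative_semiring U for U (structure) +
  assumes two_eq_four: "\<one> \<oplus> \<one> = \<one> \<oplus> \<one> \<oplus> \<one> \<oplus> \<one>"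
    and add_same_ghost: "\<lbrakk>a \<in> carrier U; b \<in> carrier U; a \<oplus> a = b \<oplus> b\<rbrakk> \<Longrightarrow> a \<oplus> b = a \<oplus> a"
    and add_distinct_ghosts: "\<lbrakk>a \<in> carrier U; b \<in> carrier U; a \<oplus> a \<noteq> b \<oplus> b\<rbrakk>
      \<Longrightarrow> a \<oplus> b \<in> {a, b}"

definition ghost_unit :: "('a, 'm) ring_scheme \<Rightarrow> 'a" where
  "ghost_unit U = \<one>\<^bsub>U\<^esub> \<oplus>\<^bsub>U\<^esub> \<one>\<^bsub>U\<^esub>"

definition ghost_ideal :: "('a, 'm) ring_scheme \<Rightarrow> 'a set" where
  "ghost_ideal U = (\<lambda>x. ghost_unit U \<otimes>\<^bsub>U\<^esub> x) ` carrier U"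

definition ghost_semiring :: "('a, 'm) ring_scheme \<Rightarrow> ('a, 'm) ring_scheme" where
  "ghost_semiring U = U\<lparr>carrier := ghost_ideal U, one := ghost_unit U\<rparr>"

text \<open>The equation \<open>eU = M\<close> of semirings is read as an identification \<open>\<iota>\<close> of \<open>M\<close> with \<open>eU\<close>;
  literal equality is the case where \<open>\<iota>\<close> is the identity. This is needed already for the
  disjoint union \<open>U(v)\<close> below, whose ghosts are the tagged elements \<open>Inr x\<close>.\<close>

definition ghost_identification ::
  "('m, 'b) ring_scheme \<Rightarrow> ('u, 'c) ring_scheme \<Rightarrow> ('m \<Rightarrow> 'u) \<Rightarrow> bool" where
  "ghost_identification M U \<iota> \<longleftrightarrow>
     \<iota> \<in> ring_iso M (ghost_semiring U) \<and> \<iota> \<zero>\<^bsub>M\<^esub> = \<zero>\<^bsub>U\<^esub>"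

section \<open>Supervaluations, dominance, transmissive maps\<close>

locale supervaluation = R?: commutative_semiring R + U?: supertropical_semiring U
  for R :: "('r, 'a) ring_scheme" (structure)
    and U :: "('u, 'c) ring_scheme" (structure)
    and \<psi> :: "'r \<Rightarrow> 'u" +
  assumes sv_closed: "\<psi> \<in> carrier R \<rightarrow> carrier U"
    and sv_zero: "\<psi> \<zero>\<^bsub>R\<^esub> = \<zero>\<^bsub>U\<^esub>"
    and sv_one: "\<psi> \<one>\<^bsub>R\<^esub> = \<one>\<^bsub>U\<^esub>"
    and sv_mult: "\<lbrakk>a \<in> carrier R; b \<in> carrier R\<rbrakk> \<Longrightarrow> \<psi> (a \<otimes>\<^bsub>R\<^esub> b) = \<psi> a \<otimes>\<^bsub>U\<^esub> \<psi> b"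
    and sv_add: "\<lbrakk>a \<in> carrier R; b \<in> carrier R\<rbrakk>
      \<Longrightarrow> bip_le U (ghost_unit U \<otimes>\<^bsub>U\<^esub> \<psi> (a \<oplus>\<^bsub>R\<^esub> b))
                   (ghost_unit U \<otimes>\<^bsub>U\<^esub> \<psi> a \<oplus>\<^bsub>U\<^esub> ghost_unit U \<otimes>\<^bsub>U\<^esub> \<psi> b)"

definition supervaluation_covering ::
  "('r, 'a) ring_scheme \<Rightarrow> ('m, 'b) ring_scheme \<Rightarrow> ('r \<Rightarrow> 'm) \<Rightarrow>
   ('u, 'c) ring_scheme \<Rightarrow> ('m \<Rightarrow> 'u) \<Rightarrow> ('r \<Rightarrow> 'u) \<Rightarrow> bool" where
  "supervaluation_covering R M v U \<iota> \<psi> \<longleftrightarrow>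
     supervaluation R U \<psi> \<and> ghost_identification M U \<iota> \<and>
     (\<forall>a\<in>carrier R. ghost_unit U \<otimes>\<^bsub>U\<^esub> \<psi> a = \<iota> (v a))"

definition dominates ::
  "('r, 'a) ring_scheme \<Rightarrow> ('u, 'c) ring_scheme \<Rightarrow> ('r \<Rightarrow> 'u) \<Rightarrow>
   ('w, 'd) ring_scheme \<Rightarrow> ('r \<Rightarrow> 'w) \<Rightarrow> bool" where
  "dominates R U \<phi> V \<psi> \<longleftrightarrow>
     supervaluation R U \<phi> \<and> supervaluation R V \<psi> \<and>
     (\<forall>a\<in>carrier R. \<forall>b\<in>carrier R.
        (\<phi> a = \<phi> b \<longrightarrow> \<psi> a = \<psi> b) \<and>
        (bip_le U (ghost_unit U \<otimes>\<^bsub>U\<^esub> \<phi> a) (ghost_unit U \<otimes>\<^bsub>U\<^esub> \<phi> b) \<longrightarrow>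
         bip_le V (ghost_unit V \<otimes>\<^bsub>V\<^esub> \<psi> a) (ghost_unit V \<otimes>\<^bsub>V\<^esub> \<psi> b)) \<and>
        (\<phi> a \<in> ghost_ideal U \<longrightarrow> \<psi> a \<in> ghost_ideal V))"

locale transmissive = U?: supertropical_semiring U + V?: supertropical_semiring V
  for U :: "('u, 'c) ring_scheme" (structure)
    and V :: "('w, 'd) ring_scheme" (structure)
    and \<alpha> :: "'u \<Rightarrow> 'w" +
  assumes tm_closed: "\<alpha> \<in> carrier U \<rightarrow> carrier V"
    and tm_zero: "\<alpha> \<zero>\<^bsub>U\<^esub> = \<zero>\<^bsub>V\<^esub>"
    and tm_one: "\<alpha> \<one>\<^bsub>U\<^esub> = \<one>\<^bsub>V\<^esub>"
    and tm_mult: "\<lbrakk>x \<in> carrier U; y \<in> carrier U\<rbrakk> \<Longrightarrow> \<alpha> (x \<otimes>\<^bsub>U\<^esub> y) = \<alpha> x \<otimes>\<^bsub>V\<^esub> \<alpha> y"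
    and tm_ghost_unit: "\<alpha> (ghost_unit U) = ghost_unit V"
    and tm_add: "\<lbrakk>x \<in> ghost_ideal U; y \<in> ghost_ideal U\<rbrakk> \<Longrightarrow> \<alpha> (x \<oplus>\<^bsub>U\<^esub> y) = \<alpha> x \<oplus>\<^bsub>V\<^esub> \<alpha> y"

text \<open>\<open>\<alpha> : U \<rightarrow> V\<close> covers \<open>\<gamma> : M \<rightarrow> N\<close>, where \<open>\<iota>\<close> and \<open>\<kappa>\<close> identify \<open>M\<close> with \<open>eU\<close> and
  \<open>N\<close> with \<open>eV\<close>.\<close>

definition transmissive_covering ::
  "('m, 'b) ring_scheme \<Rightarrow> ('n, 'e) ring_scheme \<Rightarrow> ('m \<Rightarrow> 'n) \<Rightarrow>
   ('u, 'c) ring_scheme \<Rightarrow> ('m \<Rightarrow> 'u) \<Rightarrow> ('w, 'd) ring_scheme \<Rightarrow> ('n \<Rightarrow> 'w) \<Rightarrow>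
   ('u \<Rightarrow> 'w) \<Rightarrow> bool" where
  "transmissive_covering M N \<gamma> U \<iota> V \<kappa> \<alpha> \<longleftrightarrow>
     transmissive U V \<alpha> \<and> ghost_identification M U \<iota> \<and> ghost_identification N V \<kappa> \<and>
     (\<forall>x\<in>carrier M. \<alpha> (\<iota> x) = \<kappa> (\<gamma> x))"

section \<open>The semiring \<open>U(v)\<close> and the supervaluation \<open>\<phi>\<^sub>v\<close>\<close>

text \<open>The element \<open>e x\<close> of \<open>M\<close> for \<open>x\<close> in \<open>U(v)\<close>.\<close>

definition Uv_ghost :: "('r \<Rightarrow> 'm) \<Rightarrow> 'r + 'm \<Rightarrow> 'm" where
  "Uv_ghost v x = (case x of Inl a \<Rightarrow> v a | Inr y \<Rightarrow> y)"

definition Uv_mult ::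
  "('r, 'a) ring_scheme \<Rightarrow> ('m, 'b) ring_scheme \<Rightarrow> ('r \<Rightarrow> 'm) \<Rightarrow> 'r + 'm \<Rightarrow> 'r + 'm \<Rightarrow> 'r + 'm"
  where
  "Uv_mult R M v x y = (case (x, y) of
       (Inl a, Inl b) \<Rightarrow> Inl (a \<otimes>\<^bsub>R\<^esub> b)
     | (Inl a, Inr z) \<Rightarrow> Inr (v a \<otimes>\<^bsub>M\<^esub> z)
     | (Inr z, Inl a) \<Rightarrow> Inr (v a \<otimes>\<^bsub>M\<^esub> z)
     | (Inr w, Inr z) \<Rightarrow> Inr (w \<otimes>\<^bsub>M\<^esub> z))"

definition Uv_add :: "('m, 'b) ring_scheme \<Rightarrow> ('r \<Rightarrow> 'm) \<Rightarrow> 'r + 'm \<Rightarrow> 'r + 'm \<Rightarrow> 'r + 'm" where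
  "Uv_add M v x y =
     (if bip_less M (Uv_ghost v y) (Uv_ghost v x) then x
      else if bip_less M (Uv_ghost v x) (Uv_ghost v y) then y
      else Inr (Uv_ghost v x))"

definition Uv ::
  "('r, 'a) ring_scheme \<Rightarrow> ('m, 'b) ring_scheme \<Rightarrow> ('r \<Rightarrow> 'm) \<Rightarrow> ('r + 'm) ring" where
  "Uv R M v =
     \<lparr>carrier = {a \<in> carrier R. v a \<noteq> \<zero>\<^bsub>M\<^esub>} <+> carrier M,
      monoid.mult = Uv_mult R M v,
      one = Inl \<one>\<^bsub>R\<^esub>,
      zero = Inr \<zero>\<^bsub>M\<^esub>,
      add = Uv_add M v\<rparr>"

definition phi_v :: "('m, 'b) ring_scheme \<Rightarrow> ('r \<Rightarrow> 'm) \<Rightarrow> 'r \<Rightarrow> 'r + 'm" where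
  "phi_v M v a = (if v a = \<zero>\<^bsub>M\<^esub> then Inr \<zero>\<^bsub>M\<^esub> else Inl a)"

end

theory Submission
  imports Defs
begin

text \<open>
  The element \<open>Inl a\<close> of \<open>U(v)\<close> remembers \<open>a\<close> itself, so \<open>\<phi>\<^sub>v\<close> is injective except that it sends
  the support \<open>v\<^sup>-\<^sup>1(0)\<close> to zero. A supervaluation \<open>\<psi>\<close> covering \<open>v\<close> has no choice there: in a
  supertropical semiring \<open>e x = 0\<close> forces \<open>x = 0\<close> (\<open>zero_if_ghost_zero\<close>), so \<open>\<psi>\<close> kills the support
  as well. This is the first condition of dominance; the ghost levels of both maps are given
  by \<open>v\<close>, which settles the other two.

  For the same reason every covering \<open>\<psi>\<close> factors through \<open>\<phi>\<^sub>v\<close>: put \<open>\<alpha> (Inl a) = \<psi> a\<close> and let \<open>\<alpha>\<close>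
  be the identification \<open>\<iota>\<close> on the ghosts. The only product that mixes the two parts is
  \<open>Inl a \<cdot> Inr z = Inr (v a z)\<close>, and it is respected because ghosts absorb \<open>e\<close>, so that
  \<open>\<psi> a \<iota> z = e \<psi> a \<iota> z = \<iota> (v a) \<iota> z\<close>. Both prescriptions are forced, as \<open>U(v)\<close> consists of the
  values of \<open>\<phi>\<^sub>v\<close> and the ghosts, and uniqueness follows.

  A map covering an identification of ghosts is additive because the addition of a supertropical
  semiring is determined by the ghost levels: the summand of larger level wins, and two summands
  of equal level give their common ghost. An injective additive map of ghosts
  preserves both comparisons.

  That \<open>U(v)\<close> is a semiring at all depends on cancellation in \<open>M \ {0}\<close>. It makes multiplication
  by a nonzero element strictly monotone (\<open>mult_strict_mono\<close>), so that the winner of \<open>y + z\<close> is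
  still the winner after multiplication by \<open>x\<close>; this is distributivity.
\<close>

section \<open>The order of a bipotent semiring\<close>

context bipotent_semiring
begin

lemma bip_le_trans:
  assumes "bip_le M x y" "bip_le M y z" "x \<in> carrier M" "y \<in> carrier M" "z \<in> carrier M"
  shows "bip_le M x z"
  using assms a_assoc[of x y z] unfolding bip_le_def by metis

lemma bip_less_asym:
  "\<lbrakk>bip_less M x y; x \<in> carrier M; y \<in> carrier M\<rbrakk> \<Longrightarrow> \<not> bip_less M y x"
  using a_comm[of x y] by (auto simp: bip_less_def bip_le_def)

lemma bip_less_irrefl: "\<not> bip_less M x x"
  by (simp add: bip_less_def)

lemma bip_less_trans:
  assumes "bip_less M x y" "bip_less M y z" "x \<in> carrier M" "y \<in> carrier M" "z \<in> carrier M"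
  shows "bip_less M x z"
  using assms bip_le_trans[of x y z] bip_less_asym[of x y] unfolding bip_less_def by blast

lemma bip_less_linear:
  assumes "x \<in> carrier M" "y \<in> carrier M"
  obtains "bip_less M x y" | "x = y" | "bip_less M y x"
  using assms bipotent[of x y] a_comm[of x y] by (auto simp: bip_less_def bip_le_def)

lemma add_of_less: "bip_less M x y \<Longrightarrow> x \<oplus> y = y"
  by (simp add: bip_less_def bip_le_def)

lemma add_of_greater:
  "\<lbrakk>bip_less M y x; x \<in> carrier M; y \<in> carrier M\<rbrakk> \<Longrightarrow> x \<oplus> y = x"
  using a_comm[of x y] by (simp add: bip_less_def bip_le_def)

lemma add_idem: "x \<in> carrier M \<Longrightarrow> x \<oplus> x = x"
  using bipotent[of x x] by auto

lemma mult_mono: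
  assumes "bip_le M x y" "x \<in> carrier M" "y \<in> carrier M" "z \<in> carrier M"
  shows "bip_le M (z \<otimes> x) (z \<otimes> y)"
  using assms r_distr[of x y z] by (simp add: bip_le_def)

end

section \<open>Ghosts in supertropical semirings\<close>

context supertropical_semiring
begin

lemma ghost_unit_closed: "ghost_unit U \<in> carrier U"
  by (simp add: ghost_unit_def)

lemma ghost_unit_mult: "x \<in> carrier U \<Longrightarrow> ghost_unit U \<otimes> x = x \<oplus> x"
  by (simp add: ghost_unit_def l_distr)

lemma ghost_unit_idem: "ghost_unit U \<otimes> ghost_unit U = ghost_unit U"
  using two_eq_four
  by (simp add: ghost_unit_mult ghost_unit_closed) (simp add: ghost_unit_def a_assoc)

lemma ghost_unit_absorb:
  assumes "x \<in> ghost_ideal U" shows "ghost_unit U \<otimes> x = x"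
proof -
  obtain y where "y \<in> carrier U" "x = ghost_unit U \<otimes> y"
    using assms by (auto simp: ghost_ideal_def)
  then show ?thesis
    using m_assoc[of "ghost_unit U" "ghost_unit U" y] by (simp add: ghost_unit_closed ghost_unit_idem)
qed

lemma ghost_ideal_closed: "x \<in> ghost_ideal U \<Longrightarrow> x \<in> carrier U"
  by (auto simp: ghost_ideal_def ghost_unit_closed)

lemma zero_in_ghost_ideal: "\<zero> \<in> ghost_ideal U"
  unfolding ghost_ideal_def by (rule image_eqI[of _ _ \<zero>]) (simp_all add: ghost_unit_closed)

text \<open>If \<open>e x = 0\<close>, then \<open>x\<close> and \<open>0\<close> have the same ghost, so their sum \<open>x\<close> is that ghost.\<close>

lemma zero_if_ghost_zero:
  assumes "x \<in> carrier U" "ghost_unit U \<otimes> x = \<zero>" shows "x = \<zero>"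
  using assms add_same_ghost[of x \<zero>] by (simp add: ghost_unit_mult)

lemma add_of_equal_ghosts:
  assumes "x \<in> carrier U" "y \<in> carrier U" "ghost_unit U \<otimes> x = ghost_unit U \<otimes> y"
  shows "x \<oplus> y = ghost_unit U \<otimes> x"
  using assms add_same_ghost[of x y] by (simp add: ghost_unit_mult)

text \<open>The sum is one of the summands, and \<open>e (x + y) = e x + e y\<close> tells which one.\<close>

lemma add_of_larger_ghost:
  assumes "x \<in> carrier U" "y \<in> carrier U" "ghost_unit U \<otimes> x \<noteq> ghost_unit U \<otimes> y"
    and "ghost_unit U \<otimes> x \<oplus> ghost_unit U \<otimes> y = ghost_unit U \<otimes> x"
  shows "x \<oplus> y = x"
proof -
  have "x \<oplus> y \<in> {x, y}"
    using assms(1-3) add_distinct_ghosts[of x y] by (simp add: ghost_unit_mult)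
  moreover have "ghost_unit U \<otimes> (x \<oplus> y) = ghost_unit U \<otimes> x"
    using assms by (simp add: r_distr ghost_unit_closed)
  ultimately show ?thesis
    using assms(3) by auto
qed

end

lemma ghost_semiring_simps:
  "carrier (ghost_semiring U) = ghost_ideal U"
  "\<one>\<^bsub>ghost_semiring U\<^esub> = ghost_unit U"
  "x \<otimes>\<^bsub>ghost_semiring U\<^esub> y = x \<otimes>\<^bsub>U\<^esub> y"
  "x \<oplus>\<^bsub>ghost_semiring U\<^esub> y = x \<oplus>\<^bsub>U\<^esub> y"
  by (simp_all add: ghost_semiring_def)

lemma ghost_identification_iff:
  "ghost_identification M U \<iota> \<longleftrightarrow>
     bij_betw \<iota> (carrier M) (ghost_ideal U) \<and>
     (\<forall>x\<in>carrier M. \<forall>y\<in>carrier M.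
        \<iota> (x \<otimes>\<^bsub>M\<^esub> y) = \<iota> x \<otimes>\<^bsub>U\<^esub> \<iota> y \<and> \<iota> (x \<oplus>\<^bsub>M\<^esub> y) = \<iota> x \<oplus>\<^bsub>U\<^esub> \<iota> y) \<and>
     \<iota> \<one>\<^bsub>M\<^esub> = ghost_unit U \<and> \<iota> \<zero>\<^bsub>M\<^esub> = \<zero>\<^bsub>U\<^esub>"
  by (auto simp: ghost_identification_def ring_iso_def ring_hom_def ghost_semiring_simps
      dest: bij_betwE)

section \<open>The supertropical semiring \<open>U(v)\<close>\<close>

lemma Uv_simps:
  "carrier (Uv R M v) = {a \<in> carrier R. v a \<noteq> \<zero>\<^bsub>M\<^esub>} <+> carrier M"
  "x \<otimes>\<^bsub>Uv R M v\<^esub> y = Uv_mult R M v x y"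
  "\<one>\<^bsub>Uv R M v\<^esub> = Inl \<one>\<^bsub>R\<^esub>"
  "\<zero>\<^bsub>Uv R M v\<^esub> = Inr \<zero>\<^bsub>M\<^esub>"
  "x \<oplus>\<^bsub>Uv R M v\<^esub> y = Uv_add M v x y"
  by (simp_all add: Uv_def)

lemma Uv_ghost_simps [simp]: "Uv_ghost v (Inl a) = v a" "Uv_ghost v (Inr z) = z"
  by (simp_all add: Uv_ghost_def)

lemma Uv_mult_simps [simp]:
  "Uv_mult R M v (Inl a) (Inl b) = Inl (a \<otimes>\<^bsub>R\<^esub> b)"
  "Uv_mult R M v (Inl a) (Inr z) = Inr (v a \<otimes>\<^bsub>M\<^esub> z)"
  "Uv_mult R M v (Inr z) (Inl a) = Inr (v a \<otimes>\<^bsub>M\<^esub> z)"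
  "Uv_mult R M v (Inr w) (Inr z) = Inr (w \<otimes>\<^bsub>M\<^esub> z)"
  by (simp_all add: Uv_mult_def)

context valuation
begin

lemma val_in: "a \<in> carrier R \<Longrightarrow> v a \<in> carrier M"
  using val_closed by auto

lemma mult_nonzero:
  "\<lbrakk>x \<in> carrier M; y \<in> carrier M; x \<noteq> \<zero>\<^bsub>M\<^esub>; y \<noteq> \<zero>\<^bsub>M\<^esub>\<rbrakk> \<Longrightarrow> x \<otimes>\<^bsub>M\<^esub> y \<noteq> \<zero>\<^bsub>M\<^esub>"
  using nonzero_closed[of x y] by auto

lemma one_nonzero: "\<one>\<^bsub>M\<^esub> \<noteq> \<zero>\<^bsub>M\<^esub>"
proof
  assume "\<one>\<^bsub>M\<^esub> = \<zero>\<^bsub>M\<^esub>"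
  then have "x = \<zero>\<^bsub>M\<^esub>" if "x \<in> carrier M" for x
    using that M.l_one[of x] M.l_null[of x] by simp
  then show False
    using nontrivial M.zero_closed by blast
qed

text \<open>Cancellation upgrades monotonicity to strictness; it does not apply when the smaller
  factor is zero, where closure of the nonzero elements takes its place.\<close>

lemma mult_strict_mono:
  assumes "bip_less M x y" "x \<in> carrier M" "y \<in> carrier M" "z \<in> carrier M" "z \<noteq> \<zero>\<^bsub>M\<^esub>"
  shows "bip_less M (z \<otimes>\<^bsub>M\<^esub> x) (z \<otimes>\<^bsub>M\<^esub> y)"
proof -
  have y: "y \<noteq> \<zero>\<^bsub>M\<^esub>"
    using assms by (auto simp: bip_less_def bip_le_def)
  have "z \<otimes>\<^bsub>M\<^esub> x \<noteq> z \<otimes>\<^bsub>M\<^esub> y"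
  proof (cases "x = \<zero>\<^bsub>M\<^esub>")
    case True
    then show ?thesis
      using mult_nonzero[of z y] assms y by auto
  next
    case False
    then show ?thesis
      using nonzero_cancel[of z x y] assms y by (auto simp: bip_less_def)
  qed
  then show ?thesis
    using assms M.mult_mono[of x y z] by (simp add: bip_less_def)
qed

lemma Uv_ghost_closed: "x \<in> carrier (Uv R M v) \<Longrightarrow> Uv_ghost v x \<in> carrier M"
  by (auto simp: Uv_simps val_in)

lemma Inr_in_Uv: "Inr z \<in> carrier (Uv R M v) \<longleftrightarrow> z \<in> carrier M"
  by (auto simp: Uv_simps)

lemma Uv_mult_closed:
  "\<lbrakk>x \<in> carrier (Uv R M v); y \<in> carrier (Uv R M v)\<rbrakk>
    \<Longrightarrow> Uv_mult R M v x y \<in> carrier (Uv R M v)"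
  by (auto simp: Uv_simps val_in val_mult mult_nonzero)

lemma Uv_ghost_mult:
  "\<lbrakk>x \<in> carrier (Uv R M v); y \<in> carrier (Uv R M v)\<rbrakk>
    \<Longrightarrow> Uv_ghost v (Uv_mult R M v x y) = Uv_ghost v x \<otimes>\<^bsub>M\<^esub> Uv_ghost v y"
  by (auto simp: Uv_simps val_in val_mult M.m_comm)

lemma Uv_mult_Inr:
  "\<lbrakk>x \<in> carrier (Uv R M v); z \<in> carrier M\<rbrakk>
    \<Longrightarrow> Uv_mult R M v x (Inr z) = Inr (Uv_ghost v x \<otimes>\<^bsub>M\<^esub> z)"
  by (auto simp: Uv_simps)

lemma Uv_ghost_eq_zero_iff:
  "x \<in> carrier (Uv R M v) \<Longrightarrow> Uv_ghost v x = \<zero>\<^bsub>M\<^esub> \<longleftrightarrow> x = Inr \<zero>\<^bsub>M\<^esub>"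
  by (auto simp: Uv_simps)

lemma Uv_add_of_greater:
  "bip_less M (Uv_ghost v y) (Uv_ghost v x) \<Longrightarrow> Uv_add M v x y = x"
  by (simp add: Uv_add_def)

lemma Uv_add_of_less:
  "\<lbrakk>bip_less M (Uv_ghost v x) (Uv_ghost v y); x \<in> carrier (Uv R M v); y \<in> carrier (Uv R M v)\<rbrakk>
    \<Longrightarrow> Uv_add M v x y = y"
  using M.bip_less_asym[OF _ Uv_ghost_closed Uv_ghost_closed] by (simp add: Uv_add_def)

lemma Uv_add_of_equal:
  "Uv_ghost v x = Uv_ghost v y \<Longrightarrow> Uv_add M v x y = Inr (Uv_ghost v y)"
  by (simp add: Uv_add_def M.bip_less_irrefl)

text \<open>Comparing the ghosts of two elements decides their sum.\<close>

lemma Uv_add_cases: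
  assumes "x \<in> carrier (Uv R M v)" "y \<in> carrier (Uv R M v)"
  obtains (less) "bip_less M (Uv_ghost v x) (Uv_ghost v y)" "Uv_add M v x y = y"
  | (equal) "Uv_ghost v x = Uv_ghost v y" "Uv_add M v x y = Inr (Uv_ghost v y)"
  | (greater) "bip_less M (Uv_ghost v y) (Uv_ghost v x)" "Uv_add M v x y = x"
  using M.bip_less_linear[OF Uv_ghost_closed Uv_ghost_closed, OF assms] assms
    Uv_add_of_less Uv_add_of_equal Uv_add_of_greater by metis

lemma Uv_add_closed:
  assumes "x \<in> carrier (Uv R M v)" "y \<in> carrier (Uv R M v)"
  shows "Uv_add M v x y \<in> carrier (Uv R M v)"
  using assms by (cases rule: Uv_add_cases[OF assms]) (auto simp: Inr_in_Uv Uv_ghost_closed)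

lemma Uv_add_Inr:
  assumes "x \<in> carrier M" "y \<in> carrier M"
  shows "Uv_add M v (Inr x) (Inr y) = Inr (x \<oplus>\<^bsub>M\<^esub> y)"
  by (rule Uv_add_cases[of "Inr x" "Inr y"])
    (use assms in \<open>auto simp: Inr_in_Uv M.add_of_less M.add_of_greater M.add_idem\<close>)

lemma Uv_add_comm:
  assumes "x \<in> carrier (Uv R M v)" "y \<in> carrier (Uv R M v)"
  shows "Uv_add M v x y = Uv_add M v y x"
  using assms
  by (cases rule: Uv_add_cases[OF assms])
    (simp_all add: Uv_add_of_less Uv_add_of_greater Uv_add_of_equal)

text \<open>The order of \<open>Uv_ghost v x\<close> and \<open>Uv_ghost v y\<close>, and that of \<open>Uv_ghost v y\<close> and
  \<open>Uv_ghost v z\<close>, settle both bracketings, except when \<open>y\<close> lies below both; then both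
  bracketings are \<open>x + z\<close>.\<close>

lemma Uv_add_assoc:
  assumes x: "x \<in> carrier (Uv R M v)" and y: "y \<in> carrier (Uv R M v)"
    and z: "z \<in> carrier (Uv R M v)"
  shows "Uv_add M v (Uv_add M v x y) z = Uv_add M v x (Uv_add M v y z)"
proof -
  note closed = x y z Uv_ghost_closed[OF x] Uv_ghost_closed[OF y] Uv_ghost_closed[OF z]
    Uv_ghost_closed[OF x, folded Inr_in_Uv] Uv_ghost_closed[OF y, folded Inr_in_Uv]
    Uv_ghost_closed[OF z, folded Inr_in_Uv]
  have trans1: "bip_less M (Uv_ghost v x) (Uv_ghost v z)"
    if "bip_less M (Uv_ghost v x) (Uv_ghost v y)" "bip_less M (Uv_ghost v y) (Uv_ghost v z)"
    using that M.bip_less_trans closed by blast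
  have trans2: "bip_less M (Uv_ghost v z) (Uv_ghost v x)"
    if "bip_less M (Uv_ghost v z) (Uv_ghost v y)" "bip_less M (Uv_ghost v y) (Uv_ghost v x)"
    using that M.bip_less_trans closed by blast
  show ?thesis
    by (cases rule: Uv_add_cases[OF x y]; cases rule: Uv_add_cases[OF y z])
      (simp_all add: closed trans1 trans2 Uv_add_of_less Uv_add_of_greater Uv_add_of_equal)
qed

lemma Uv_distrib:
  assumes x: "x \<in> carrier (Uv R M v)" and y: "y \<in> carrier (Uv R M v)"
    and z: "z \<in> carrier (Uv R M v)"
  shows "Uv_mult R M v x (Uv_add M v y z) = Uv_add M v (Uv_mult R M v x y) (Uv_mult R M v x z)"
proof (cases "Uv_ghost v x = \<zero>\<^bsub>M\<^esub>")
  case True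
  \<comment> \<open>Only \<open>0\<close> has ghost \<open>0\<close>, and then both sides are \<open>0\<close>.\<close>
  have null: "Uv_mult R M v x w = Inr \<zero>\<^bsub>M\<^esub>" if "w \<in> carrier (Uv R M v)" for w
    using that True Uv_ghost_eq_zero_iff[of "Uv_mult R M v x w"]
    by (simp add: x Uv_mult_closed Uv_ghost_mult Uv_ghost_closed)
  show ?thesis
    using null y z Uv_add_closed by (simp add: Uv_add_of_equal)
next
  case False
  note strict = mult_strict_mono[OF _ _ _ Uv_ghost_closed[OF x] False]
  show ?thesis
    by (cases rule: Uv_add_cases[OF y z])
      (simp_all add: x y z strict Uv_mult_closed Uv_ghost_mult Uv_ghost_closed Uv_mult_Inr
        Uv_add_of_less Uv_add_of_greater Uv_add_of_equal)
qed

lemma Uv_mult_comm: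
  "\<lbrakk>x \<in> carrier (Uv R M v); y \<in> carrier (Uv R M v)\<rbrakk>
    \<Longrightarrow> Uv_mult R M v x y = Uv_mult R M v y x"
  by (auto simp: Uv_simps R.m_comm M.m_comm)

lemma Uv_mult_assoc:
  "\<lbrakk>x \<in> carrier (Uv R M v); y \<in> carrier (Uv R M v); z \<in> carrier (Uv R M v)\<rbrakk>
    \<Longrightarrow> Uv_mult R M v (Uv_mult R M v x y) z = Uv_mult R M v x (Uv_mult R M v y z)"
  by (auto simp: Uv_simps R.m_assoc M.m_assoc val_in val_mult M.m_comm M.m_lcomm)

lemma commutative_semiring_Uv: "commutative_semiring (Uv R M v)"
proof -
  have one: "Inl \<one> \<in> carrier (Uv R M v)"
    by (simp add: Uv_simps InlI val_one one_nonzero)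
  have l_one: "Uv_mult R M v (Inl \<one>) x = x" if "x \<in> carrier (Uv R M v)" for x
    using that by (auto simp: Uv_simps val_one)
  have zero: "Inr \<zero>\<^bsub>M\<^esub> \<in> carrier (Uv R M v)"
    by (simp add: Inr_in_Uv)
  have l_zero: "Uv_add M v (Inr \<zero>\<^bsub>M\<^esub>) x = x" if "x \<in> carrier (Uv R M v)" for x
    using zero that
  proof (cases rule: Uv_add_cases)
    case greater
    then show ?thesis
      using Uv_ghost_closed[OF that] by (simp add: bip_less_def bip_le_def)
  next
    case equal
    then show ?thesis
      using that by (metis Uv_ghost_simps(2) Uv_ghost_eq_zero_iff)
  qed simp
  have l_null: "Uv_mult R M v (Inr \<zero>\<^bsub>M\<^esub>) x = Inr \<zero>\<^bsub>M\<^esub>" if "x \<in> carrier (Uv R M v)" for x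
    using that by (auto simp: Uv_simps val_in)
  have comm_mult: "comm_monoid (Uv R M v)"
    by (rule comm_monoidI)
      (simp_all only: Uv_simps(2-5) one l_one Uv_mult_closed Uv_mult_assoc, rule Uv_mult_comm)
  have comm_add: "abelian_monoid (Uv R M v)"
    by (rule abelian_monoidI)
      (simp_all only: Uv_simps(2-5) zero l_zero Uv_add_closed Uv_add_assoc, rule Uv_add_comm)
  interpret mult: comm_monoid "Uv R M v" by (fact comm_mult)
  have r_distrib:
    "Uv_mult R M v (Uv_add M v x y) z = Uv_add M v (Uv_mult R M v x z) (Uv_mult R M v y z)"
    if "x \<in> carrier (Uv R M v)" "y \<in> carrier (Uv R M v)" "z \<in> carrier (Uv R M v)" for x y z
    using that Uv_distrib[of z x y] Uv_mult_comm Uv_add_closed by metis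
  have r_null: "Uv_mult R M v x (Inr \<zero>\<^bsub>M\<^esub>) = Inr \<zero>\<^bsub>M\<^esub>" if "x \<in> carrier (Uv R M v)" for x
    using l_null[OF that] Uv_mult_comm[OF that zero] by simp
  have "semiring (Uv R M v)"
    by (rule semiring.intro[OF comm_add mult.monoid_axioms semiring_axioms.intro])
      (simp_all only: Uv_simps(2-5) Uv_distrib r_distrib l_null r_null)
  then show ?thesis
    using comm_mult by (simp add: commutative_semiring_def)
qed

lemma ghost_unit_Uv: "ghost_unit (Uv R M v) = Inr \<one>\<^bsub>M\<^esub>"
  by (simp add: ghost_unit_def Uv_simps Uv_add_of_equal val_one)

lemma supertropical_Uv: "supertropical_semiring (Uv R M v)"
proof -
  have "a \<oplus>\<^bsub>Uv R M v\<^esub> a = Inr (Uv_ghost v a)" for a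
    by (simp add: Uv_simps Uv_add_of_equal)
  moreover have "a \<oplus>\<^bsub>Uv R M v\<^esub> b \<in> {a, b}"
    if "a \<in> carrier (Uv R M v)" "b \<in> carrier (Uv R M v)" "Uv_ghost v a \<noteq> Uv_ghost v b" for a b
    using that(3) by (cases rule: Uv_add_cases[OF that(1,2)]) (auto simp: Uv_simps(5))
  moreover have "\<one>\<^bsub>Uv R M v\<^esub> \<oplus>\<^bsub>Uv R M v\<^esub> \<one>\<^bsub>Uv R M v\<^esub> =
    \<one>\<^bsub>Uv R M v\<^esub> \<oplus>\<^bsub>Uv R M v\<^esub> \<one>\<^bsub>Uv R M v\<^esub> \<oplus>\<^bsub>Uv R M v\<^esub> \<one>\<^bsub>Uv R M v\<^esub> \<oplus>\<^bsub>Uv R M v\<^esub> \<one>\<^bsub>Uv R M v\<^esub>"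
    by (simp add: Uv_simps Uv_add_of_equal val_one)
  ultimately show ?thesis
    using commutative_semiring_Uv
    by (intro supertropical_semiring.intro supertropical_semiring_axioms.intro)
      (simp_all add: Uv_simps(5) Uv_add_of_equal)
qed

lemma ghost_unit_mult_Uv:
  "x \<in> carrier (Uv R M v) \<Longrightarrow> ghost_unit (Uv R M v) \<otimes>\<^bsub>Uv R M v\<^esub> x = Inr (Uv_ghost v x)"
  by (auto simp: ghost_unit_Uv Uv_simps val_in)

lemma ghost_ideal_Uv: "ghost_ideal (Uv R M v) = Inr ` carrier M"
proof
  show "ghost_ideal (Uv R M v) \<subseteq> Inr ` carrier M"
    by (auto simp: ghost_ideal_def ghost_unit_mult_Uv Uv_ghost_closed)
  show "Inr ` carrier M \<subseteq> ghost_ideal (Uv R M v)"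
    unfolding ghost_ideal_def
    by (auto intro!: image_eqI[of _ _ "Inr _"] simp: ghost_unit_mult_Uv Inr_in_Uv)
qed

lemma ghost_identification_Uv: "ghost_identification M (Uv R M v) Inr"
  by (auto simp: ghost_identification_iff ghost_ideal_Uv ghost_unit_Uv Uv_simps Uv_add_Inr
      intro!: inj_on_imp_bij_betw)

section \<open>The supervaluation \<open>\<phi>\<^sub>v\<close> and its dominance\<close>

lemma phi_v_closed: "a \<in> carrier R \<Longrightarrow> phi_v M v a \<in> carrier (Uv R M v)"
  by (auto simp: phi_v_def Uv_simps)

lemma Uv_ghost_phi_v: "Uv_ghost v (phi_v M v a) = v a"
  by (simp add: phi_v_def)

lemma supervaluation_covering_phi_v:
  "supervaluation_covering R M v (Uv R M v) Inr (phi_v M v)"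
proof -
  have mult: "phi_v M v (a \<otimes> b) = phi_v M v a \<otimes>\<^bsub>Uv R M v\<^esub> phi_v M v b"
    if "a \<in> carrier R" "b \<in> carrier R" for a b
    using that by (auto simp: phi_v_def Uv_simps val_mult val_in mult_nonzero)
  have ghost: "ghost_unit (Uv R M v) \<otimes>\<^bsub>Uv R M v\<^esub> phi_v M v a = Inr (v a)"
    if "a \<in> carrier R" for a
    using that by (simp add: ghost_unit_mult_Uv phi_v_closed Uv_ghost_phi_v)
  have add: "bip_le (Uv R M v) (Inr (v (a \<oplus> b))) (Inr (v a) \<oplus>\<^bsub>Uv R M v\<^esub> Inr (v b))"
    if "a \<in> carrier R" "b \<in> carrier R" for a b
    using that val_add[of a b] by (simp add: bip_le_def Uv_simps Uv_add_Inr val_in)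
  have "supervaluation R (Uv R M v) (phi_v M v)"
    unfolding supervaluation_def supervaluation_axioms_def
    using R.commutative_semiring_axioms supertropical_Uv mult add
    by (auto simp: phi_v_closed ghost) (simp_all add: phi_v_def Uv_simps val_zero val_one one_nonzero)
  then show ?thesis
    by (simp add: supervaluation_covering_def ghost_identification_Uv ghost)
qed

end

text \<open>The map \<open>\<phi>\<^sub>v\<close> is injective off the support of \<open>v\<close> and collapses the support to zero. So this
  is what a covering supervaluation must satisfy to factor through \<open>\<phi>\<^sub>v\<close> as a map of sets.\<close>

lemma covering_zero_on_support:
  assumes "supervaluation_covering R M v U \<iota> \<psi>" "a \<in> carrier R" "v a = \<zero>\<^bsub>M\<^esub>"
  shows "\<psi> a = \<zero>\<^bsub>U\<^esub>"
proof -
  interpret supervaluation R U \<psi>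
    using assms(1) by (simp add: supervaluation_covering_def)
  have "ghost_unit U \<otimes>\<^bsub>U\<^esub> \<psi> a = \<iota> (v a)" "\<iota> \<zero>\<^bsub>M\<^esub> = \<zero>\<^bsub>U\<^esub>"
    using assms(1,2) by (simp_all add: supervaluation_covering_def ghost_identification_def)
  then show ?thesis
    using assms(2,3) sv_closed U.zero_if_ghost_zero[of "\<psi> a"] by auto
qed

context valuation
begin

lemma phi_v_dominates:
  assumes cov: "supervaluation_covering R M v U \<iota> \<psi>"
  shows "dominates R (Uv R M v) (phi_v M v) U \<psi>"
proof -
  interpret psi: supervaluation R U \<psi>
    using cov by (simp add: supervaluation_covering_def)
  have ghost_psi: "ghost_unit U \<otimes>\<^bsub>U\<^esub> \<psi> a = \<iota> (v a)" if "a \<in> carrier R" for a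
    using cov that by (simp add: supervaluation_covering_def)
  have iota_add: "\<iota> (x \<oplus>\<^bsub>M\<^esub> y) = \<iota> x \<oplus>\<^bsub>U\<^esub> \<iota> y" if "x \<in> carrier M" "y \<in> carrier M" for x y
    using cov that by (simp add: supervaluation_covering_def ghost_identification_iff)
  have zero: "\<psi> a = \<zero>\<^bsub>U\<^esub>" if "a \<in> carrier R" "v a = \<zero>\<^bsub>M\<^esub>" for a
    using covering_zero_on_support[OF cov] that by blast
  have D1: "\<psi> a = \<psi> b"
    if "a \<in> carrier R" "b \<in> carrier R" "phi_v M v a = phi_v M v b" for a b
    using that zero[of a] zero[of b] by (auto simp: phi_v_def split: if_splits)
  have D2: "bip_le U (ghost_unit U \<otimes>\<^bsub>U\<^esub> \<psi> a) (ghost_unit U \<otimes>\<^bsub>U\<^esub> \<psi> b)"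
    if "a \<in> carrier R" "b \<in> carrier R"
      "bip_le (Uv R M v) (ghost_unit (Uv R M v) \<otimes>\<^bsub>Uv R M v\<^esub> phi_v M v a)
        (ghost_unit (Uv R M v) \<otimes>\<^bsub>Uv R M v\<^esub> phi_v M v b)" for a b
  proof -
    have "v a \<oplus>\<^bsub>M\<^esub> v b = v b"
      using that
      by (simp add: bip_le_def ghost_unit_mult_Uv phi_v_closed Uv_ghost_phi_v Uv_simps(5)
          Uv_add_Inr val_in)
    then show ?thesis
      using that(1,2) iota_add[of "v a" "v b"] by (simp add: bip_le_def ghost_psi val_in)
  qed
  have D3: "\<psi> a \<in> ghost_ideal U"
    if "a \<in> carrier R" "phi_v M v a \<in> ghost_ideal (Uv R M v)" for a
    using that zero[of a] psi.zero_in_ghost_ideal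
    by (auto simp: phi_v_def ghost_ideal_Uv split: if_splits)
  have phi: "supervaluation R (Uv R M v) (phi_v M v)"
    using supervaluation_covering_phi_v by (simp add: supervaluation_covering_def)
  show ?thesis
    unfolding dominates_def
    by (intro conjI ballI impI)
      (((rule phi | rule psi.supervaluation_axioms | rule D1 | rule D2 | rule D3); assumption)+)
qed

section \<open>Transmissive maps from \<open>U(v)\<close>\<close>

lemma transmissive_covering_ghost:
  assumes "transmissive_covering M M id (Uv R M v) Inr U \<iota> \<alpha>" "x \<in> carrier (Uv R M v)"
  shows "ghost_unit U \<otimes>\<^bsub>U\<^esub> \<alpha> x = \<iota> (Uv_ghost v x)"
proof -
  interpret tm: transmissive "Uv R M v" U \<alpha>
    using assms(1) by (simp add: transmissive_covering_def)
  have "ghost_unit U \<otimes>\<^bsub>U\<^esub> \<alpha> x = \<alpha> (ghost_unit (Uv R M v) \<otimes>\<^bsub>Uv R M v\<^esub> x)"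
    using assms(2) by (simp add: tm.tm_mult tm.tm_ghost_unit tm.U.ghost_unit_closed)
  then show ?thesis
    using assms by (simp add: transmissive_covering_def ghost_unit_mult_Uv Uv_ghost_closed)
qed

text \<open>Injectivity of \<open>\<iota>\<close> keeps strict comparisons of ghosts strict; a transmissive map that
  identifies two ghost levels is in general not additive.\<close>

lemma transmissive_covering_hom:
  assumes cov: "transmissive_covering M M id (Uv R M v) Inr U \<iota> \<alpha>"
  shows "\<alpha> \<in> semiring_hom (Uv R M v) U"
proof -
  interpret tm: transmissive "Uv R M v" U \<alpha>
    using cov by (simp add: transmissive_covering_def)
  have inj: "inj_on \<iota> (carrier M)"
    and iota_add: "\<And>x y. \<lbrakk>x \<in> carrier M; y \<in> carrier M\<rbrakk> \<Longrightarrow> \<iota> (x \<oplus>\<^bsub>M\<^esub> y) = \<iota> x \<oplus>\<^bsub>U\<^esub> \<iota> y"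
    using cov by (auto simp: transmissive_covering_def ghost_identification_iff bij_betw_def)
  note ghost = transmissive_covering_ghost[OF cov]
  have closed: "\<alpha> x \<in> carrier U" if "x \<in> carrier (Uv R M v)" for x
    using tm.tm_closed that by auto
  have larger: "\<alpha> x \<oplus>\<^bsub>U\<^esub> \<alpha> y = \<alpha> x"
    if x: "x \<in> carrier (Uv R M v)" and y: "y \<in> carrier (Uv R M v)"
      and less: "bip_less M (Uv_ghost v y) (Uv_ghost v x)" for x y
  proof (rule tm.add_of_larger_ghost)
    show "ghost_unit U \<otimes>\<^bsub>U\<^esub> \<alpha> x \<noteq> ghost_unit U \<otimes>\<^bsub>U\<^esub> \<alpha> y"
      using less inj x y by (auto simp: ghost inj_on_eq_iff Uv_ghost_closed bip_less_def)
    show "ghost_unit U \<otimes>\<^bsub>U\<^esub> \<alpha> x \<oplus>\<^bsub>U\<^esub> ghost_unit U \<otimes>\<^bsub>U\<^esub> \<alpha> y = ghost_unit U \<otimes>\<^bsub>U\<^esub> \<alpha> x"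
      using less x y
      by (simp add: ghost iota_add[symmetric] Uv_ghost_closed M.add_of_greater)
  qed (use x y closed in auto)
  have add: "\<alpha> (x \<oplus>\<^bsub>Uv R M v\<^esub> y) = \<alpha> x \<oplus>\<^bsub>U\<^esub> \<alpha> y"
    if x: "x \<in> carrier (Uv R M v)" and y: "y \<in> carrier (Uv R M v)" for x y
    using x y
  proof (cases rule: Uv_add_cases)
    case less
    then show ?thesis
      using larger[OF y x] x y closed by (simp add: Uv_simps tm.V.a_comm)
  next
    case equal
    have "\<alpha> x \<oplus>\<^bsub>U\<^esub> \<alpha> y = \<iota> (Uv_ghost v y)"
      using equal(1) x y closed by (simp add: tm.V.add_of_equal_ghosts ghost)
    then show ?thesis
      using equal(2) cov y by (simp add: Uv_simps transmissive_covering_def Uv_ghost_closed)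
  next
    case greater
    then show ?thesis
      using larger[OF x y] by (simp add: Uv_simps)
  qed
  show ?thesis
    using add tm.tm_closed tm.tm_mult tm.tm_one tm.tm_zero
    by (auto simp: semiring_hom_def ring_hom_def)
qed

lemma supervaluation_covering_compose:
  assumes cov: "transmissive_covering M M id (Uv R M v) Inr U \<iota> \<alpha>"
  shows "supervaluation_covering R M v U \<iota> (compose (carrier R) \<alpha> (phi_v M v))"
proof -
  interpret tm: transmissive "Uv R M v" U \<alpha>
    using cov by (simp add: transmissive_covering_def)
  interpret phi: supervaluation R "Uv R M v" "phi_v M v"
    using supervaluation_covering_phi_v by (simp add: supervaluation_covering_def)
  have id: "ghost_identification M U \<iota>"
    using cov by (simp add: transmissive_covering_def)
  then have iota_add: "\<iota> (x \<oplus>\<^bsub>M\<^esub> y) = \<iota> x \<oplus>\<^bsub>U\<^esub> \<iota> y" if "x \<in> carrier M" "y \<in> carrier M" for x y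
    using that by (simp add: ghost_identification_iff)
  have ghost: "ghost_unit U \<otimes>\<^bsub>U\<^esub> \<alpha> (phi_v M v a) = \<iota> (v a)" if "a \<in> carrier R" for a
    using that by (simp add: transmissive_covering_ghost[OF cov] phi_v_closed Uv_ghost_phi_v)
  have add: "bip_le U (\<iota> (v (a \<oplus> b))) (\<iota> (v a) \<oplus>\<^bsub>U\<^esub> \<iota> (v b))"
    if "a \<in> carrier R" "b \<in> carrier R" for a b
    using that val_add[of a b] by (simp add: bip_le_def iota_add[symmetric] val_in)
  have closed: "\<alpha> (phi_v M v a) \<in> carrier U" if "a \<in> carrier R" for a
    using that tm.tm_closed phi_v_closed by auto
  have "supervaluation R U (compose (carrier R) \<alpha> (phi_v M v))"
    unfolding supervaluation_def supervaluation_axioms_def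
    using R.commutative_semiring_axioms tm.V.supertropical_semiring_axioms add closed
    by (auto simp: compose_eq ghost phi.sv_zero phi.sv_one phi.sv_mult tm.tm_zero tm.tm_one
        tm.tm_mult phi_v_closed)
  then show ?thesis
    by (simp add: supervaluation_covering_def id compose_eq ghost)
qed

text \<open>A transmissive map covering the identity of \<open>M\<close> is given on the ghosts, and off the ghosts
  every element of \<open>U(v)\<close> is a value of \<open>\<phi>\<^sub>v\<close>.\<close>

lemma inj_on_compose_phi_v:
  "inj_on (\<lambda>\<alpha>. compose (carrier R) \<alpha> (phi_v M v))
    {\<alpha> \<in> extensional (carrier (Uv R M v)).
       transmissive_covering M M id (Uv R M v) Inr U \<iota> \<alpha>}"
proof (rule inj_onI, clarify)
  fix \<alpha> \<beta>
  assume ext: "\<alpha> \<in> extensional (carrier (Uv R M v))" "\<beta> \<in> extensional (carrier (Uv R M v))"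
    and cov: "transmissive_covering M M id (Uv R M v) Inr U \<iota> \<alpha>"
      "transmissive_covering M M id (Uv R M v) Inr U \<iota> \<beta>"
    and eq: "compose (carrier R) \<alpha> (phi_v M v) = compose (carrier R) \<beta> (phi_v M v)"
  show "\<alpha> = \<beta>"
  proof (rule extensionalityI[OF ext])
    fix x assume "x \<in> carrier (Uv R M v)"
    then consider a where "a \<in> carrier R" "x = phi_v M v a" | z where "z \<in> carrier M" "x = Inr z"
      by (auto simp: Uv_simps phi_v_def)
    then show "\<alpha> x = \<beta> x"
    proof cases
      case 1
      then show ?thesis
        using fun_cong[OF eq, of a] by (simp add: compose_eq)
    next
      case 2
      then show ?thesis
        using cov by (simp add: transmissive_covering_def)
    qed
  qed
qed

lemma transmissive_factorization:
  assumes cov: "supervaluation_covering R M v U \<iota> \<psi>"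
  defines "\<alpha> \<equiv> restrict (case_sum \<psi> \<iota>) (carrier (Uv R M v))"
  shows "transmissive_covering M M id (Uv R M v) Inr U \<iota> \<alpha>"
    and "a \<in> carrier R \<Longrightarrow> \<alpha> (phi_v M v a) = \<psi> a"
proof -
  interpret psi: supervaluation R U \<psi>
    using cov by (simp add: supervaluation_covering_def)
  have id: "ghost_identification M U \<iota>"
    and ghost_psi: "\<And>a. a \<in> carrier R \<Longrightarrow> ghost_unit U \<otimes>\<^bsub>U\<^esub> \<psi> a = \<iota> (v a)"
    using cov by (simp_all add: supervaluation_covering_def)
  have iota_ghost: "\<iota> x \<in> ghost_ideal U" if "x \<in> carrier M" for x
    using id that by (auto simp: ghost_identification_iff dest: bij_betwE)
  have iota_closed: "\<iota> x \<in> carrier U" if "x \<in> carrier M" for x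
    using iota_ghost[OF that] by (rule psi.ghost_ideal_closed)
  have psi_closed: "\<psi> a \<in> carrier U" if "a \<in> carrier R" for a
    using psi.sv_closed that by auto
  have iota_hom: "\<iota> \<one>\<^bsub>M\<^esub> = ghost_unit U" "\<iota> \<zero>\<^bsub>M\<^esub> = \<zero>\<^bsub>U\<^esub>"
    "\<And>x y. \<lbrakk>x \<in> carrier M; y \<in> carrier M\<rbrakk> \<Longrightarrow> \<iota> (x \<otimes>\<^bsub>M\<^esub> y) = \<iota> x \<otimes>\<^bsub>U\<^esub> \<iota> y"
    "\<And>x y. \<lbrakk>x \<in> carrier M; y \<in> carrier M\<rbrakk> \<Longrightarrow> \<iota> (x \<oplus>\<^bsub>M\<^esub> y) = \<iota> x \<oplus>\<^bsub>U\<^esub> \<iota> y"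
    using id by (simp_all add: ghost_identification_iff)
  have mixed: "\<iota> (v a) \<otimes>\<^bsub>U\<^esub> \<iota> z = \<psi> a \<otimes>\<^bsub>U\<^esub> \<iota> z" if "a \<in> carrier R" "z \<in> carrier M" for a z
  proof -
    have "\<iota> (v a) \<otimes>\<^bsub>U\<^esub> \<iota> z = ghost_unit U \<otimes>\<^bsub>U\<^esub> \<psi> a \<otimes>\<^bsub>U\<^esub> \<iota> z"
      using that by (simp add: ghost_psi)
    also have "\<dots> = \<psi> a \<otimes>\<^bsub>U\<^esub> (ghost_unit U \<otimes>\<^bsub>U\<^esub> \<iota> z)"
      using that
      by (simp add: psi.U.m_assoc psi.U.m_lcomm psi_closed iota_closed psi.U.ghost_unit_closed)
    also have "\<dots> = \<psi> a \<otimes>\<^bsub>U\<^esub> \<iota> z"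
      using that by (simp add: psi.U.ghost_unit_absorb iota_ghost)
    finally show ?thesis .
  qed
  have \<alpha>_Inl: "\<alpha> (Inl a) = \<psi> a" if "a \<in> carrier R" "v a \<noteq> \<zero>\<^bsub>M\<^esub>" for a
    using that by (simp add: \<alpha>_def Uv_simps InlI)
  have \<alpha>_Inr: "\<alpha> (Inr z) = \<iota> z" if "z \<in> carrier M" for z
    using that by (simp add: \<alpha>_def Uv_simps InrI)
  have closed: "\<alpha> x \<in> carrier U" if "x \<in> carrier (Uv R M v)" for x
    using that by (auto simp: Uv_simps \<alpha>_Inl \<alpha>_Inr psi_closed iota_closed)
  have mult: "\<alpha> (x \<otimes>\<^bsub>Uv R M v\<^esub> y) = \<alpha> x \<otimes>\<^bsub>U\<^esub> \<alpha> y"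
    if "x \<in> carrier (Uv R M v)" "y \<in> carrier (Uv R M v)" for x y
    using that
    by (auto simp: Uv_simps \<alpha>_Inl \<alpha>_Inr val_in val_mult mult_nonzero psi.sv_mult mixed
        iota_hom psi.U.m_comm[of "\<iota> _" "\<psi> _"] psi_closed iota_closed)
  have add: "\<alpha> (x \<oplus>\<^bsub>Uv R M v\<^esub> y) = \<alpha> x \<oplus>\<^bsub>U\<^esub> \<alpha> y"
    if "x \<in> ghost_ideal (Uv R M v)" "y \<in> ghost_ideal (Uv R M v)" for x y
    using that by (auto simp: ghost_ideal_Uv Uv_simps Uv_add_Inr \<alpha>_Inr iota_hom)
  have "transmissive (Uv R M v) U \<alpha>"
    unfolding transmissive_def transmissive_axioms_def
    using supertropical_Uv psi.U.supertropical_semiring_axioms closed mult add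
    by (auto simp: ghost_unit_Uv \<alpha>_Inr iota_hom)
      (simp_all add: Uv_simps \<alpha>_Inl \<alpha>_Inr iota_hom val_one one_nonzero psi.sv_one)
  then show "transmissive_covering M M id (Uv R M v) Inr U \<iota> \<alpha>"
    by (simp add: transmissive_covering_def ghost_identification_Uv id \<alpha>_Inr)
  show "\<alpha> (phi_v M v a) = \<psi> a" if "a \<in> carrier R"
    using that covering_zero_on_support[OF cov, of a]
    by (simp add: phi_v_def \<alpha>_Inl \<alpha>_Inr iota_hom)
qed

lemma bij_betw_compose_phi_v:
  "bij_betw (\<lambda>\<alpha>. compose (carrier R) \<alpha> (phi_v M v))
    {\<alpha> \<in> extensional (carrier (Uv R M v)).
       transmissive_covering M M id (Uv R M v) Inr U \<iota> \<alpha>}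
    {\<psi> \<in> extensional (carrier R). supervaluation_covering R M v U \<iota> \<psi>}"
  (is "bij_betw ?F ?T ?S")
  unfolding bij_betw_def
proof (intro conjI equalityI subsetI)
  show "inj_on ?F ?T"
    by (rule inj_on_compose_phi_v)
  show "\<psi> \<in> ?S" if "\<psi> \<in> ?F ` ?T" for \<psi>
    using that supervaluation_covering_compose by (auto simp: compose_extensional)
  show "\<psi> \<in> ?F ` ?T" if "\<psi> \<in> ?S" for \<psi>
  proof
    let ?\<alpha> = "restrict (case_sum \<psi> \<iota>) (carrier (Uv R M v))"
    have cov: "supervaluation_covering R M v U \<iota> \<psi>" and ext: "\<psi> \<in> extensional (carrier R)"
      using that by auto
    show "?\<alpha> \<in> ?T"
      using transmissive_factorization(1)[OF cov] by simp
    show "\<psi> = ?F ?\<alpha>"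
      by (rule extensionalityI[OF ext compose_extensional])
        (simp only: compose_eq transmissive_factorization(2)[OF cov])
  qed
qed

end

section \<open>The universal property of \<open>\<phi>\<^sub>v\<close>\<close>

theorem corollary5p14:
  fixes R :: "('r, 'a) ring_scheme" and M :: "('m, 'b) ring_scheme" and v :: "'r \<Rightarrow> 'm"
    and U :: "('u, 'c) ring_scheme" and \<iota> :: "'m \<Rightarrow> 'u"
  assumes "valuation R M v"
    and "supertropical_semiring U"
    and "ghost_identification M U \<iota>"
  shows "supervaluation_covering R M v (Uv R M v) Inr (phi_v M v) \<and>
    (\<forall>\<psi>. supervaluation_covering R M v U \<iota> \<psi> \<longrightarrow>
          dominates R (Uv R M v) (phi_v M v) U \<psi>) \<and>
    bij_betw (\<lambda>\<alpha>. compose (carrier R) \<alpha> (phi_v M v))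
      {\<alpha> \<in> extensional (carrier (Uv R M v)).
         transmissive_covering M M id (Uv R M v) Inr U \<iota> \<alpha>}
      {\<psi> \<in> extensional (carrier R). supervaluation_covering R M v U \<iota> \<psi>} \<and>
    (\<forall>\<alpha>. transmissive_covering M M id (Uv R M v) Inr U \<iota> \<alpha> \<longrightarrow>
          \<alpha> \<in> semiring_hom (Uv R M v) U)"
proof -
  interpret valuation R M v by (fact assms(1))
  show ?thesis
    using supervaluation_covering_phi_v phi_v_dominates bij_betw_compose_phi_v
      transmissive_covering_hom by blast
qed

end
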